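(* The continuous order property does not hold in general for the capacitated stochastic inventory problem. Specifically, consider the instance with $4$ periods, $K=250$, $B=41$, $h=1$, $p=26$, $v=0$, and independent demands with the probability mass functions $d_1$: $34\,(0.018)$, $159\,(0.888)$, $281\,(0.046)$, $286\,(0.048)$; $d_2$: $14\,(0.028)$, $223\,(0.271)$, $225\,(0.170)$, $232\,(0.531)$; $d_3$: $5\,(0.041)$, $64\,(0.027)$, $115\,(0.889)$, $171\,(0.043)$; $d_4$: $35\,(0.069)$, $48\,(0.008)$, $145\,(0.019)$, $210\,(0.904)$. In period $1$ of this instance the optimal order quantity is $0$ for every starting inventory level $x\in\{602,603,\dots,615\}$, while it is $41$ for every starting inventory level $x\in\{616,617,618\}$; hence the continuous order property is violated.
   Context: Here periods are numbered in chronological order $t=1,\dots,4$; inventory levels and order quantities are integers; demand that cannot be met is backordered and deliveries are instantaneous. With $\mathcal C_5\equiv 0$, for $t=4,3,2,1$ and integer $x$ the minimum expected cost from period $t$ on, with starting inventory $x$, is $$\mathcal C_t(x)=\min_{Q\in\{0,1,\dots,B\}}\Big\{K\,\mathbf 1[Q>0]+vQ+h\,E[\max(x+Q-d_t,0)]+p\,E[\max(d_t-x-Q,0)]+E[\mathcal C_{t+1}(x+Q-d_t)]\Big\}.$$ An optimal order quantity at $x$ in period $t$ is a minimizing $Q$; it is optimal to place an order at $x$ if a positive $Q$ is minimizing. The continuous order property (in period $t$) states: whenever it is optimal to place an order at an inventory level $x_0$, it is optimal to place an order at every $y<x_0$. *)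

theory Defs
  imports "HOL-Probability.Probability"
begin

record inventory_problem =
  periods :: nat
  fixed_cost :: real
  unit_cost :: real
  holding_cost :: real
  penalty_cost :: real
  capacity :: nat
  demand :: "nat \<Rightarrow> nat pmf"

text \<open>
  The field \<open>demand\<close> gives the law of the demand in each period \<open>1, \<dots>, periods\<close>. The
  demands are independent, so a demand path \<open>\<omega>\<close>, with \<open>\<omega> t\<close> the demand in period \<open>t\<close>, is
  distributed according to the product law.
\<close>

definition demand_law :: "inventory_problem \<Rightarrow> (nat \<Rightarrow> nat) pmf" where
  "demand_law I = Pi_pmf {1..periods I} 0 (demand I)"

abbreviation expect :: "inventory_problem \<Rightarrow> ((nat \<Rightarrow> nat) \<Rightarrow> real) \<Rightarrow> real" where
  "expect I X \<equiv> measure_pmf.expectation (demand_law I) X"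

text \<open>
  The expected cost of ordering \<open>Q\<close> at inventory level \<open>x\<close> in period \<open>t\<close>, when \<open>V\<close> is the
  expected cost from period \<open>t + 1\<close> on as a function of the inventory level.
\<close>

definition order_cost ::
    "inventory_problem \<Rightarrow> nat \<Rightarrow> (int \<Rightarrow> real) \<Rightarrow> int \<Rightarrow> nat \<Rightarrow> real" where
  "order_cost I t V x Q =
     fixed_cost I * (if Q > 0 then 1 else 0) + unit_cost I * real Q
     + holding_cost I * expect I (\<lambda>\<omega>. real_of_int (max (x + int Q - int (\<omega> t)) 0))
     + penalty_cost I * expect I (\<lambda>\<omega>. real_of_int (max (int (\<omega> t) - x - int Q) 0))
     + expect I (\<lambda>\<omega>. V (x + int Q - int (\<omega> t)))"

function min_cost :: "inventory_problem \<Rightarrow> nat \<Rightarrow> int \<Rightarrow> real" where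
  "min_cost I t x =
     (if t > periods I then 0
      else Min ((\<lambda>Q. order_cost I t (\<lambda>y. min_cost I (Suc t) y) x Q) ` {0..capacity I}))"
  by pat_completeness auto
termination
  by (relation "Wellfounded.measure (\<lambda>(I, t, x). Suc (periods I) - t)") auto

declare min_cost.simps [simp del]

definition optimal_quantities :: "inventory_problem \<Rightarrow> nat \<Rightarrow> int \<Rightarrow> nat set" where
  "optimal_quantities I t x =
     {Q \<in> {0..capacity I}. \<forall>Q' \<in> {0..capacity I}.
        order_cost I t (min_cost I (Suc t)) x Q \<le> order_cost I t (min_cost I (Suc t)) x Q'}"

definition optimal_to_order :: "inventory_problem \<Rightarrow> nat \<Rightarrow> int \<Rightarrow> bool" where
  "optimal_to_order I t x \<longleftrightarrow> (\<exists>Q \<in> optimal_quantities I t x. Q > 0)"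

definition continuous_order_property :: "inventory_problem \<Rightarrow> nat \<Rightarrow> bool" where
  "continuous_order_property I t \<longleftrightarrow>
     (\<forall>x0. optimal_to_order I t x0 \<longrightarrow> (\<forall>y < x0. optimal_to_order I t y))"

text \<open>
  The admissible data. Finite mean demand makes all expectations in the recursion exist, since
  all costs grow at most linearly in the inventory level.
\<close>

definition capacitated_inventory_problem :: "inventory_problem \<Rightarrow> bool" where
  "capacitated_inventory_problem I \<longleftrightarrow>
     fixed_cost I > 0 \<and> unit_cost I \<ge> 0 \<and> holding_cost I > 0 \<and> penalty_cost I > 0 \<and>
     capacity I > 0 \<and>
     (\<forall>t \<in> {1..periods I}. integrable (measure_pmf (demand I t)) real)"

definition counterexample_pmf_list :: "nat \<Rightarrow> (nat \<times> real) list" where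
  "counterexample_pmf_list t =
     (if t = 1 then [(34, 0.018), (159, 0.888), (281, 0.046), (286, 0.048)]
      else if t = 2 then [(14, 0.028), (223, 0.271), (225, 0.170), (232, 0.531)]
      else if t = 3 then [(5, 0.041), (64, 0.027), (115, 0.889), (171, 0.043)]
      else [(35, 0.069), (48, 0.008), (145, 0.019), (210, 0.904)])"

text \<open>Well-formedness is what makes \<open>pmf_of_list\<close> below have the listed probabilities.\<close>

lemma pmf_of_list_wf_counterexample: "pmf_of_list_wf (counterexample_pmf_list t)"
  by (auto simp: pmf_of_list_wf_def counterexample_pmf_list_def)

definition counterexample :: inventory_problem where
  "counterexample =
     \<lparr> periods = 4, fixed_cost = 250, unit_cost = 0, holding_cost = 1, penalty_cost = 26,
       capacity = 41, demand = (\<lambda>t. pmf_of_list (counterexample_pmf_list t)) \<rparr>"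

end

(*
  All probabilities are multiples of 1/1000, so multiplying the costs with n periods to go by 1000^n
  makes the recursion integral. Only finitely
  many inventory levels are reachable from the levels in question, so the cost of every post-order
  level can be tabulated backwards in time, the minimum over the 41 positive order quantities being
  a sliding-window minimum obtained by repeatedly doubling the window.
*)

theory Submission
  imports Defs
begin

section \<open>Expectations\<close>

text \<open>Each list entry contributes to exactly one summand on the left, the one at its own
  point, so the masses of repeated points add up.\<close>

lemma sum_pmf_of_list_masses:
  fixes f :: "'a \<Rightarrow> real"
  assumes "finite A" "fst ` set xs \<subseteq> A"
  shows "(\<Sum>a\<in>A. f a * sum_list (map snd (filter (\<lambda>z. fst z = a) xs)))
    = (\<Sum>(a, p)\<leftarrow>xs. p * f a)"
  using assms(2)
proof (induction xs)
  case (Cons z xs)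
  have "(\<Sum>a\<in>A. f a * sum_list (map snd (filter (\<lambda>z. fst z = a) (z # xs))))
      = (\<Sum>a\<in>A. (if a = fst z then snd z * f a else 0)
          + f a * sum_list (map snd (filter (\<lambda>z. fst z = a) xs)))"
    by (intro sum.cong) (auto simp: algebra_simps)
  also have "\<dots> = snd z * f (fst z) + (\<Sum>(a, p)\<leftarrow>xs. p * f a)"
    using Cons assms(1) by (simp add: sum.distrib)
  finally show ?case
    by (cases z) (simp only: list.map sum_list.Cons prod.case fst_conv snd_conv)
qed simp

lemma expectation_pmf_of_list:
  fixes f :: "'a \<Rightarrow> real"
  assumes "pmf_of_list_wf xs"
  shows "measure_pmf.expectation (pmf_of_list xs) f = (\<Sum>(a, p)\<leftarrow>xs. p * f a)"
proof -
  have "measure_pmf.expectation (pmf_of_list xs) f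
      = (\<Sum>a\<in>fst ` set xs. f a * pmf (pmf_of_list xs) a)"
    using set_pmf_of_list[OF assms] by (intro integral_measure_pmf_real) auto
  also have "\<dots> = (\<Sum>(a, p)\<leftarrow>xs. p * f a)"
    by (simp add: pmf_pmf_of_list[OF assms] sum_pmf_of_list_masses)
  finally show ?thesis .
qed

text \<open>The integrand depends on one coordinate only, and the marginal of a product law is its
  factor.\<close>

lemma expect_demand:
  fixes f :: "nat \<Rightarrow> real"
  assumes "t \<in> {1..periods I}"
  shows "expect I (\<lambda>\<omega>. f (\<omega> t)) = measure_pmf.expectation (demand I t) f"
proof -
  have "expect I (\<lambda>\<omega>. f (\<omega> t))
      = measure_pmf.expectation (map_pmf (\<lambda>\<omega>. \<omega> t) (demand_law I)) f"
    by simp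
  also have "map_pmf (\<lambda>\<omega>. \<omega> t) (demand_law I) = demand I t"
    using assms by (simp add: demand_law_def Pi_pmf_component)
  finally show ?thesis .
qed

section \<open>The recursion in integers\<close>

definition int_demand :: "nat \<Rightarrow> (int \<times> int) list" where
  "int_demand t =
     (if t = 1 then [(34, 18), (159, 888), (281, 46), (286, 48)]
      else if t = 2 then [(14, 28), (223, 271), (225, 170), (232, 531)]
      else if t = 3 then [(5, 41), (64, 27), (115, 889), (171, 43)]
      else [(35, 69), (48, 8), (145, 19), (210, 904)])"

text \<open>If \<open>V\<close> is in units of \<open>1 / s\<close>, this is the expected cost at
  post-order level \<open>y\<close>, without the fixed cost, in units of
  \<open>1 / (1000 * s)\<close>: the weights \<open>w\<close> are probabilities in
  thousandths.\<close>

definition int_level :: "(int \<times> int) list \<Rightarrow> int \<Rightarrow> (int \<Rightarrow> int) \<Rightarrow> int \<Rightarrow> int" where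
  "int_level D s V y =
     (\<Sum>(d, w)\<leftarrow>D. w * (s * (max (y - d) 0 + 26 * max (d - y) 0) + V (y - d)))"

definition window_min :: "(int \<Rightarrow> int) \<Rightarrow> nat \<Rightarrow> int \<Rightarrow> int" where
  "window_min G m x = Min ((\<lambda>q. G (x + int q)) ` {..<m})"

text \<open>Here \<open>n\<close> is the number of periods to go, and costs are in units of \<open>1 / 1000 ^ n\<close>.\<close>

fun int_cost :: "nat \<Rightarrow> int \<Rightarrow> int" where
  "int_cost 0 x = 0"
| "int_cost (Suc n) x =
     (let G = int_level (int_demand (4 - n)) (1000 ^ n) (int_cost n)
      in min (G x) (250 * 1000 ^ Suc n + window_min G 41 (x + 1)))"

lemma counterexample_simps [simp]:
  "periods counterexample = 4" "fixed_cost counterexample = 250"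
  "unit_cost counterexample = 0" "holding_cost counterexample = 1"
  "penalty_cost counterexample = 26" "capacity counterexample = 41"
  "demand counterexample t = pmf_of_list (counterexample_pmf_list t)"
  by (simp_all add: counterexample_def)

lemma expect_counterexample:
  fixes f :: "int \<Rightarrow> real"
  assumes "t \<in> {1..4}"
  shows "1000 * expect counterexample (\<lambda>\<omega>. f (int (\<omega> t)))
    = (\<Sum>(d, w)\<leftarrow>int_demand t. of_int w * f d)"
proof -
  have "expect counterexample (\<lambda>\<omega>. f (int (\<omega> t)))
      = (\<Sum>(d, p)\<leftarrow>counterexample_pmf_list t. p * f (int d))"
    using assms expect_demand[of t counterexample "\<lambda>d. f (int d)"]
    by (simp add: expectation_pmf_of_list pmf_of_list_wf_counterexample)
  then show ?thesis
    by (simp add: counterexample_pmf_list_def int_demand_def)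
qed

text \<open>Separates holding, penalty and future costs, so that each sum can be matched with one
  expectation in \<open>order_cost\<close>.\<close>

lemma of_int_int_level:
  assumes "\<And>y. s * V y = real_of_int (W y)" "s = of_int r"
  shows "real_of_int (int_level D r W y)
    = s * (\<Sum>(d, w)\<leftarrow>D. of_int w * of_int (max (y - d) 0))
      + 26 * s * (\<Sum>(d, w)\<leftarrow>D. of_int w * of_int (max (d - y) 0))
      + s * (\<Sum>(d, w)\<leftarrow>D. of_int w * V (y - d))"
proof (induction D)
  case (Cons z D)
  obtain d w where z: "z = (d, w)" by fastforce
  \<comment> \<open>Opaque names leave a polynomial identity for \<open>algebra\<close>.\<close>
  define a b v where "a = max (y - d) 0" and "b = max (d - y) 0" and "v = V (y - d)"
  have W: "real_of_int (W (y - d)) = s * v"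
    by (simp add: v_def assms(1))
  have "real_of_int (int_level (z # D) r W y)
      = of_int w * (s * (of_int a + 26 * of_int b) + s * v) + of_int (int_level D r W y)"
    by (simp add: int_level_def z a_def b_def W assms(2))
  also have "\<dots> = s * (of_int w * of_int a) + 26 * s * (of_int w * of_int b) + s * (of_int w * v)
      + of_int (int_level D r W y)"
    by algebra
  finally show ?case
    unfolding Cons.IH z list.map sum_list.Cons prod.case a_def[symmetric] b_def[symmetric] v_def[symmetric]
    by algebra
qed (simp add: int_level_def)

text \<open>Exactly \<open>n\<close> periods follow period \<open>4 - n\<close>. The scale
  \<open>1000 ^ n\<close> of \<open>V\<close> gains one factor 1000 from the demand weights of the
  current period.\<close>

lemma order_cost_counterexample:
  assumes "n < 4"
    and V: "\<And>y. 1000 ^ n * V y = of_int (W y)"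
  shows "1000 ^ Suc n * order_cost counterexample (4 - n) V x Q
    = of_int ((if Q > 0 then 250 * 1000 ^ Suc n else 0)
        + int_level (int_demand (4 - n)) (1000 ^ n) W (x + int Q))"
proof -
  define t y s where "t = 4 - n" and "y = x + int Q" and "s = (1000 :: real) ^ n"
  have t: "t \<in> {1..4}" using assms(1) by (auto simp: t_def)
  define a b v where "a = expect counterexample (\<lambda>\<omega>. real_of_int (max (y - int (\<omega> t)) 0))"
    and "b = expect counterexample (\<lambda>\<omega>. real_of_int (max (int (\<omega> t) - y) 0))"
    and "v = expect counterexample (\<lambda>\<omega>. V (y - int (\<omega> t)))"
  have "order_cost counterexample t V x Q = 250 * (if Q > 0 then 1 else 0) + a + 26 * b + v"
    by (simp add: order_cost_def a_def b_def v_def y_def diff_diff_eq)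
  moreover have "real_of_int (int_level (int_demand t) (1000 ^ n) W y)
      = s * (1000 * a) + 26 * s * (1000 * b) + s * (1000 * v)"
    unfolding a_def b_def v_def expect_counterexample[OF t, of "\<lambda>d. real_of_int (max (y - d) 0)"]
      expect_counterexample[OF t, of "\<lambda>d. real_of_int (max (d - y) 0)"]
      expect_counterexample[OF t, of "\<lambda>d. V (y - d)"]
    by (rule of_int_int_level) (simp_all add: s_def V)
  ultimately show ?thesis
    unfolding t_def[symmetric] y_def[symmetric] of_int_add
    by (simp add: s_def[symmetric] algebra_simps)
qed

text \<open>\<open>Q = 0\<close> avoids the fixed cost. The positive quantities
  \<open>Q = q + 1\<close> all pay \<open>K\<close>, which moves out of the minimum, and their
  post-order levels form a window starting at \<open>x + 1\<close>.\<close>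

lemma Min_fixed_cost_split:
  fixes G :: "int \<Rightarrow> int"
  assumes "m > 0"
  shows "Min ((\<lambda>Q. (if Q > 0 then K else 0) + G (x + int Q)) ` {0..m})
    = min (G x) (K + window_min G m (x + 1))"
proof -
  have "{0..m} = insert 0 (Suc ` {..<m})"
    by (simp add: atLeast0AtMost lessThan_Suc_atMost[symmetric] lessThan_Suc_eq_insert_0)
  then have "Min ((\<lambda>Q. (if Q > 0 then K else 0) + G (x + int Q)) ` {0..m})
      = Min (insert (G x) ((\<lambda>q. K + G (x + 1 + int q)) ` {..<m}))"
    by (simp add: image_image add.assoc)
  also have "\<dots> = min (G x) (Min ((\<lambda>q. K + G (x + 1 + int q)) ` {..<m}))"
    using assms by (intro Min_insert) auto
  also have "Min ((\<lambda>q. K + G (x + 1 + int q)) ` {..<m}) = K + window_min G m (x + 1)"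
    using assms mono_Min_commute[of "(+) K" "(\<lambda>q. G (x + 1 + int q)) ` {..<m}"]
    by (simp add: window_min_def image_image lessThan_empty_iff mono_def)
  finally show ?thesis .
qed

text \<open>Backward induction in time: period \<open>5 - n\<close> is the first of the last
  \<open>n\<close>. Scaling by a positive constant and embedding the integers are monotone, hence
  commute with \<open>Min\<close>.\<close>

lemma min_cost_counterexample:
  "n \<le> 4 \<Longrightarrow> 1000 ^ n * min_cost counterexample (5 - n) x = of_int (int_cost n x)"
proof (induction n arbitrary: x)
  case 0
  then show ?case by (simp add: min_cost.simps)
next
  case (Suc n)
  let ?G = "int_level (int_demand (4 - n)) (1000 ^ n) (int_cost n)"
  let ?c = "order_cost counterexample (4 - n) (min_cost counterexample (5 - n)) x"
  have "Suc (4 - n) = 5 - n" "\<not> 4 - n > 4" using Suc.prems by auto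
  then have "min_cost counterexample (5 - Suc n) x = Min (?c ` {0..41})"
    by (subst min_cost.simps) simp
  then have "1000 ^ Suc n * min_cost counterexample (5 - Suc n) x
      = Min ((*) (1000 ^ Suc n) ` ?c ` {0..41})"
    by (subst mono_Min_commute[symmetric]) (auto intro!: monoI)
  also have "(*) (1000 ^ Suc n) ` ?c ` {0..41} =
      real_of_int ` (\<lambda>Q. (if Q > 0 then 250 * 1000 ^ Suc n else 0) + ?G (x + int Q)) ` {0..41}"
    unfolding image_image using Suc
    by (intro image_cong refl order_cost_counterexample) auto
  also have "Min \<dots> = of_int (Min ((\<lambda>Q. (if Q > 0 then 250 * 1000 ^ Suc n else 0) + ?G (x + int Q)) ` {0..41}))"
    by (rule mono_Min_commute[symmetric]) (auto intro!: monoI)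
  also have "\<dots> = of_int (int_cost (Suc n) x)"
    by (subst Min_fixed_cost_split) (auto simp: Let_def)
  finally show ?case .
qed

section \<open>Tabulation\<close>

text \<open>Nothing is claimed past the end of the list, so truncation by \<open>skip\<close> and
  \<open>zip_with\<close> merely shortens the range covered and lengths need no bookkeeping until
  the final check.\<close>

definition tabulates :: "int \<Rightarrow> int list \<Rightarrow> (int \<Rightarrow> int) \<Rightarrow> bool" where
  "tabulates lo xs f \<longleftrightarrow> (\<forall>i < length xs. f (lo + int i) = xs ! i)"

text \<open>
  The following pattern-matching variants of \<open>map f [lo..hi]\<close>, \<open>drop\<close> and \<open>map2\<close> are rewritten by
  the simplifier in linear time, which the library versions are not.
\<close>

fun tabulate :: "(int \<Rightarrow> int) \<Rightarrow> nat \<Rightarrow> int \<Rightarrow> int list" where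
  "tabulate f 0 lo = []"
| "tabulate f (Suc n) lo = f lo # tabulate f n (lo + 1)"

fun skip :: "nat \<Rightarrow> 'a list \<Rightarrow> 'a list" where
  "skip 0 xs = xs"
| "skip (Suc n) [] = []"
| "skip (Suc n) (x # xs) = skip n xs"

fun zip_with :: "('a \<Rightarrow> 'b \<Rightarrow> 'c) \<Rightarrow> 'a list \<Rightarrow> 'b list \<Rightarrow> 'c list" where
  "zip_with h (x # xs) (y # ys) = h x y # zip_with h xs ys"
| "zip_with h [] ys = []"
| "zip_with h (x # xs) [] = []"

lemma skip_eq_drop: "skip n xs = drop n xs"
  by (induction n xs rule: skip.induct) auto

lemma zip_with_eq_map2: "zip_with h xs ys = map2 h xs ys"
  by (induction h xs ys rule: zip_with.induct) auto

lemma tabulates_tabulate: "tabulates lo (tabulate f n lo) f"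
proof (induction n arbitrary: lo)
  case (Suc n)
  from Suc[of "lo + 1"] show ?case
    by (auto simp: tabulates_def nth_Cons algebra_simps split: nat.split)
qed (simp add: tabulates_def)

lemma tabulates_shift: "tabulates lo xs f \<Longrightarrow> tabulates (lo + d) xs (\<lambda>y. f (y - d))"
  by (simp add: tabulates_def algebra_simps)

lemma tabulates_skip: "tabulates lo xs f \<Longrightarrow> tabulates (lo + int k) (skip k xs) f"
  by (auto simp: tabulates_def skip_eq_drop add.assoc simp flip: of_nat_add)

lemma tabulates_map: "tabulates lo xs f \<Longrightarrow> tabulates lo (map h xs) (\<lambda>y. h (f y))"
  by (simp add: tabulates_def)

lemma tabulates_zip_with:
  "tabulates lo xs f \<Longrightarrow> tabulates lo ys g \<Longrightarrow> tabulates lo (zip_with h xs ys) (\<lambda>y. h (f y) (g y))"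
  by (simp add: tabulates_def zip_with_eq_map2)

text \<open>\<open>xs\<close> starts at level \<open>lo0\<close>, the result at \<open>lo\<close>.
  Skipping \<open>lo - d - lo0\<close> entries aligns the value at \<open>y - d\<close> with level
  \<open>y\<close>.\<close>

fun level_rows :: "(int \<times> int) list \<Rightarrow> int \<Rightarrow> int \<Rightarrow> int list \<Rightarrow> int list \<Rightarrow> int list" where
  "level_rows [] lo0 lo xs base = base"
| "level_rows ((d, w) # D) lo0 lo xs base =
     zip_with (+) (map ((*) w) (skip (nat (lo - d - lo0)) xs)) (level_rows D lo0 lo xs base)"

lemma tabulates_level_rows:
  assumes "tabulates lo0 xs V" "tabulates lo base g" "\<forall>(d, w) \<in> set D. lo0 + d \<le> lo"
  shows "tabulates lo (level_rows D lo0 lo xs base) (\<lambda>y. (\<Sum>(d, w)\<leftarrow>D. w * V (y - d)) + g y)"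
  using assms(3)
proof (induction D)
  case (Cons z D)
  obtain d w where z: "z = (d, w)" by fastforce
  have "lo0 + d + int (nat (lo - d - lo0)) = lo" using Cons.prems z by simp
  then have "tabulates lo (skip (nat (lo - d - lo0)) xs) (\<lambda>y. V (y - d))"
    using tabulates_skip[OF tabulates_shift[OF assms(1), of d], of "nat (lo - d - lo0)"] by simp
  from tabulates_zip_with[OF tabulates_map[OF this, of "(*) w"] Cons.IH, of "(+)"] Cons.prems z
  show ?case by (simp add: add.assoc)
qed (simp add: assms)

definition level_table ::
    "(int \<times> int) list \<Rightarrow> int \<Rightarrow> int \<Rightarrow> int \<Rightarrow> nat \<Rightarrow> int list \<Rightarrow> int list" where
  "level_table D s lo0 lo len xs =
     level_rows D lo0 lo xs (tabulate (int_level D s (\<lambda>_. 0)) len lo)"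

text \<open>\<open>int_level\<close> is affine in \<open>V\<close>: the zero continuation gives the
  one-period cost, and the future cost is a weighted sum of shifted copies of the table of
  \<open>V\<close>.\<close>

lemma tabulates_level_table:
  assumes "tabulates lo0 xs V" "\<forall>(d, w) \<in> set D. lo0 + d \<le> lo"
  shows "tabulates lo (level_table D s lo0 lo len xs) (int_level D s V)"
proof -
  have "int_level D s V y = (\<Sum>(d, w)\<leftarrow>D. w * V (y - d)) + int_level D s (\<lambda>_. 0) y" for y
    by (induction D) (auto simp: int_level_def algebra_simps)
  then have "int_level D s V = (\<lambda>y. (\<Sum>(d, w)\<leftarrow>D. w * V (y - d)) + int_level D s (\<lambda>_. 0) y)" ..
  then show ?thesis
    unfolding level_table_def
    using tabulates_level_rows[OF assms(1) tabulates_tabulate assms(2)] by simp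
qed

section \<open>Sliding-window minima\<close>

definition widen :: "nat \<Rightarrow> int list \<Rightarrow> int list" where
  "widen k xs = zip_with min xs (skip k xs)"

text \<open>Two windows of length \<open>m\<close> at offset \<open>k\<close> overlap or abut
  because \<open>k \<le> m\<close>, so their union is a window of length
  \<open>m + k\<close>.\<close>

lemma tabulates_widen:
  assumes "tabulates lo xs (window_min G m)" "0 < m" "k \<le> m"
  shows "tabulates lo (widen k xs) (window_min G (m + k))"
proof -
  have "window_min G (m + k) = (\<lambda>x. min (window_min G m x) (window_min G m (x + int k)))"
  proof
    fix x
    have "{..<m + k} = {..<m} \<union> (\<lambda>q. k + q) ` {..<m}"
    proof (intro set_eqI iffI)
      fix i assume "i \<in> {..<m + k}"
      then show "i \<in> {..<m} \<union> (\<lambda>q. k + q) ` {..<m}"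
        using assms(3) by (cases "i < m") (auto intro!: image_eqI[of _ _ "i - k"])
    qed auto
    then show "window_min G (m + k) x = min (window_min G m x) (window_min G m (x + int k))"
      using assms(2)
      by (simp add: window_min_def image_Un image_image Min_Un lessThan_empty_iff add.assoc)
  qed
  moreover have "tabulates lo (skip k xs) (\<lambda>x. window_min G m (x + int k))"
    using tabulates_shift[OF tabulates_skip[OF assms(1), of k], of "- int k"] by simp
  ultimately show ?thesis
    using tabulates_zip_with[OF assms(1), of "skip k xs" _ min] unfolding widen_def by metis
qed

text \<open>Doubling gives window lengths 2, 4, 8, 16, 32, and the last shift 9 completes 41.
  \<open>skip 1\<close> starts the window at \<open>x + 1\<close>. The result is 41 entries shorter
  than \<open>g\<close>.\<close>

definition cost_table :: "int \<Rightarrow> int list \<Rightarrow> int list" where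
  "cost_table K g =
     zip_with (\<lambda>a b. min a (K + b)) g
       (skip 1 (widen 9 (widen 16 (widen 8 (widen 4 (widen 2 (widen 1 g)))))))"

lemma tabulates_cost_table:
  assumes "tabulates lo g G"
  shows "tabulates lo (cost_table K g) (\<lambda>x. min (G x) (K + window_min G 41 (x + 1)))"
proof -
  have "window_min G 1 = G" by (simp add: fun_eq_iff window_min_def lessThan_Suc)
  then have "tabulates lo g (window_min G 1)" using assms by simp
  from tabulates_widen[OF this, of 1]
  have "tabulates lo (widen 1 g) (window_min G 2)" by (simp add: numeral_2_eq_2)
  from tabulates_widen[OF this, of 2]
  have "tabulates lo (widen 2 (widen 1 g)) (window_min G 4)" by simp
  from tabulates_widen[OF this, of 4]
  have "tabulates lo (widen 4 (widen 2 (widen 1 g))) (window_min G 8)" by simp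
  from tabulates_widen[OF this, of 8]
  have "tabulates lo (widen 8 (widen 4 (widen 2 (widen 1 g)))) (window_min G 16)" by simp
  from tabulates_widen[OF this, of 16]
  have "tabulates lo (widen 16 (widen 8 (widen 4 (widen 2 (widen 1 g))))) (window_min G 32)" by simp
  from tabulates_widen[OF this, of 9]
  have "tabulates lo (widen 9 (widen 16 (widen 8 (widen 4 (widen 2 (widen 1 g)))))) (window_min G 41)"
    by simp
  from tabulates_shift[OF tabulates_skip[OF this, of 1], of "-1"]
  have "tabulates lo (skip 1 (widen 9 (widen 16 (widen 8 (widen 4 (widen 2 (widen 1 g)))))))
      (\<lambda>x. window_min G 41 (x + 1))"
    by simp
  from tabulates_zip_with[OF assms this, of "\<lambda>a b. min a (K + b)"]
  show ?thesis by (simp add: cost_table_def)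
qed

section \<open>One backward step of the recursion on tables\<close>

definition level_step :: "nat \<Rightarrow> int \<Rightarrow> int \<Rightarrow> nat \<Rightarrow> int list \<Rightarrow> int list" where
  "level_step n = level_table (int_demand (4 - n)) (1000 ^ n)"

definition cost_step :: "nat \<Rightarrow> int \<Rightarrow> int \<Rightarrow> nat \<Rightarrow> int list \<Rightarrow> int list" where
  "cost_step n lo0 lo len xs = cost_table (250 * 1000 ^ Suc n) (level_step n lo0 lo len xs)"

lemma tabulates_level_step:
  assumes "tabulates lo0 xs (int_cost n)" "\<forall>(d, w) \<in> set (int_demand (4 - n)). lo0 + d \<le> lo"
  shows "tabulates lo (level_step n lo0 lo len xs) (int_level (int_demand (4 - n)) (1000 ^ n) (int_cost n))"
  unfolding level_step_def by (rule tabulates_level_table[OF assms])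

lemma tabulates_cost_step:
  assumes "tabulates lo0 xs (int_cost n)" "\<forall>(d, w) \<in> set (int_demand (4 - n)). lo0 + d \<le> lo"
  shows "tabulates lo (cost_step n lo0 lo len xs) (int_cost (Suc n))"
proof -
  have "int_cost (Suc n) =
      (\<lambda>x. min (int_level (int_demand (4 - n)) (1000 ^ n) (int_cost n) x)
        (250 * 1000 ^ Suc n
          + window_min (int_level (int_demand (4 - n)) (1000 ^ n) (int_cost n)) 41 (x + 1)))"
    by (simp add: fun_eq_iff Let_def)
  then show ?thesis
    unfolding cost_step_def
    using tabulates_cost_table[OF tabulates_level_step[OF assms]] by simp
qed

section \<open>Certified values for period 1\<close>

text \<open>
  The ranges are those reachable from the post-order levels \<open>602, \<dots>, 659\<close> of period 1.
\<close>

definition period1_level_table :: "int list" where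
  "period1_level_table =
     level_step 3 316 602 58
       (cost_step 2 84 316 351
         (cost_step 1 (-87) 84 610
           (cost_step 0 (-297) (-87) 817 (tabulate (int_cost 0) 992 (-297)))))"

abbreviation period1_level :: "int \<Rightarrow> int" where
  "period1_level \<equiv> int_level (int_demand 1) (1000 ^ 3) (int_cost 3)"

text \<open>Going forward in time, each starting level drops by the largest demand (286, 232, 171,
  210), which yields the side conditions \<open>lo0 + d \<le> lo\<close>. The last level needed
  drops by the smallest demand, and every cost table requires 41 further post-order levels.\<close>

lemma tabulates_period1_level_table: "tabulates 602 period1_level_table period1_level"
proof -
  define c5 where "c5 = tabulate (int_cost 0) 992 (-297)"
  have "tabulates (-297) c5 (int_cost 0)"
    unfolding c5_def by (rule tabulates_tabulate)
  then have "tabulates (-87) (cost_step 0 (-297) (-87) 817 c5) (int_cost 1)"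
    using tabulates_cost_step[of _ _ 0] by (simp add: int_demand_def)
  then have "tabulates 84 (cost_step 1 (-87) 84 610 (cost_step 0 (-297) (-87) 817 c5)) (int_cost 2)"
    using tabulates_cost_step[of _ _ 1] by (simp add: int_demand_def numeral_2_eq_2)
  then have "tabulates 316 (cost_step 2 84 316 351
      (cost_step 1 (-87) 84 610 (cost_step 0 (-297) (-87) 817 c5))) (int_cost 3)"
    using tabulates_cost_step[of _ _ 2] by (simp add: int_demand_def numeral_3_eq_3 numeral_2_eq_2)
  from tabulates_level_step[OF this, of 602 58] show ?thesis
    unfolding period1_level_table_def c5_def[symmetric] by (simp add: int_demand_def)
qed

text \<open>Index \<open>i\<close> stands for level \<open>602 + i\<close>; the largest index used
  is \<open>16 + 41 = 57\<close>. Strict inequalities make the minimizers unique. Between two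
  positive quantities the fixed cost cancels. Quantifying over list sets keeps the condition
  executable.\<close>

definition level_certificate :: "int list \<Rightarrow> bool" where
  "level_certificate g \<longleftrightarrow>
     length g = 58 \<and>
     (\<forall>i \<in> set [0..<14]. \<forall>Q \<in> set [1..<42]. g ! i < 250 * 1000 ^ 4 + g ! (i + Q)) \<and>
     (\<forall>i \<in> set [14..<17].
        250 * 1000 ^ 4 + g ! (i + 41) < g ! i \<and>
        (\<forall>Q \<in> set [1..<41]. g ! (i + 41) < g ! (i + Q)))"

lemma level_certificate_period1: "level_certificate period1_level_table"
  \<comment> \<open>The whole table is evaluated by rewriting, in exact integer arithmetic.\<close>
  by code_simp

lemma period1_level_bounds:
  shows "x \<in> {602..615} \<Longrightarrow> Q \<in> {1..41} \<Longrightarrow> period1_level x < 250 * 1000 ^ 4 + period1_level (x + int Q)"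
    and "x \<in> {616..618} \<Longrightarrow> 250 * 1000 ^ 4 + period1_level (x + 41) < period1_level x"
    and "x \<in> {616..618} \<Longrightarrow> Q \<in> {1..40} \<Longrightarrow> period1_level (x + 41) < period1_level (x + int Q)"
proof -
  define g where "g = period1_level_table"
  note cert = level_certificate_period1[folded g_def,
      unfolded level_certificate_def set_upt Ball_def atLeastLessThan_iff]
  have level: "period1_level (602 + int i) = g ! i" if "i < 58" for i
    using tabulates_period1_level_table cert that by (simp add: tabulates_def g_def)
  define i where "i = nat (x - 602)"
  show "period1_level x < 250 * 1000 ^ 4 + period1_level (x + int Q)"
    if "x \<in> {602..615}" "Q \<in> {1..41}"
  proof -
    have i: "x = 602 + int i" "x + int Q = 602 + int (i + Q)" "i < 14"
      using that by (auto simp: i_def)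
    show ?thesis
      \<comment> \<open>The post-order level comes first: replacing \<open>x\<close> earlier would
        destroy the pattern \<open>x + int Q\<close>.\<close>
      unfolding i(2) unfolding i(1) using cert i(3) that(2) by (subst (1 2) level) auto
  qed
  show "250 * 1000 ^ 4 + period1_level (x + 41) < period1_level x" if "x \<in> {616..618}"
  proof -
    have i: "x = 602 + int i" "x + 41 = 602 + int (i + 41)" "14 \<le> i" "i < 17"
      using that by (auto simp: i_def)
    show ?thesis
      unfolding i(2) unfolding i(1) using cert i(3,4) by (subst (1 2) level) auto
  qed
  show "period1_level (x + 41) < period1_level (x + int Q)" if "x \<in> {616..618}" "Q \<in> {1..40}"
  proof -
    have i: "x + int Q = 602 + int (i + Q)" "x + 41 = 602 + int (i + 41)" "14 \<le> i" "i < 17"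
      using that by (auto simp: i_def)
    show ?thesis
      unfolding i(1,2) using cert i(3,4) that(2) by (subst (1 2) level) auto
  qed
qed

section \<open>Optimal order quantities in period 1\<close>

lemma order_cost_period1_less_iff:
  "order_cost counterexample 1 (min_cost counterexample (Suc 1)) x Q
      < order_cost counterexample 1 (min_cost counterexample (Suc 1)) x Q'
    \<longleftrightarrow> (if Q > 0 then 250 * 1000 ^ 4 else 0) + period1_level (x + int Q)
      < (if Q' > 0 then 250 * 1000 ^ 4 else 0) + period1_level (x + int Q')"
proof -
  let ?c = "order_cost counterexample 1 (min_cost counterexample (Suc 1)) x"
  \<comment> \<open>Index arithmetic for \<open>n = 3\<close>, kept apart so that the powers of 1000
    stay symbolic when the general lemma is instantiated.\<close>
  have eqs: "Suc 3 = 4" "4 - 3 = (1 :: nat)" "5 - 3 = Suc 1" by simp_all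
  have V: "1000 ^ 3 * min_cost counterexample (Suc 1) y = of_int (int_cost 3 y)" for y
    using min_cost_counterexample[of 3 y] unfolding eqs by simp
  have c: "1000 ^ 4 * ?c Q = of_int ((if Q > 0 then 250 * 1000 ^ 4 else 0) + period1_level (x + int Q))" for Q
    by (rule order_cost_counterexample[of 3 _ "int_cost 3", unfolded eqs])
      (simp_all only: V numeral_less_iff Num.less_num_simps)
  \<comment> \<open>A positive factor preserves strict order, which reduces the real comparison to
    integers.\<close>
  have "?c Q < ?c Q' \<longleftrightarrow> 1000 ^ 4 * ?c Q < 1000 ^ 4 * ?c Q'" by simp
  then show ?thesis unfolding c of_int_less_iff .
qed

lemma optimal_quantities_unique:
  assumes "Q \<le> capacity I"
    and "\<And>Q'. Q' \<le> capacity I \<Longrightarrow> Q' \<noteq> Q \<Longrightarrow>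
      order_cost I t (min_cost I (Suc t)) x Q < order_cost I t (min_cost I (Suc t)) x Q'"
  shows "optimal_quantities I t x = {Q}"
  unfolding optimal_quantities_def set_eq_iff mem_Collect_eq atLeastAtMost_iff Ball_def singleton_iff
  using assms by (metis le0 less_imp_le not_less order_refl)

text \<open>Each demand has finite support, hence finite mean.\<close>

lemma capacitated_inventory_problem_counterexample:
  "capacitated_inventory_problem counterexample"
proof -
  have "finite (set_pmf (pmf_of_list (counterexample_pmf_list t)))" for t
    using set_pmf_of_list[OF pmf_of_list_wf_counterexample] finite_subset by blast
  then show ?thesis
    by (simp add: capacitated_inventory_problem_def integrable_measure_pmf_finite)
qed

theorem mainTheorem3:
  shows "(\<forall>x \<in> {602..615}. optimal_quantities counterexample 1 x = {0})
    \<and> (\<forall>x \<in> {616..618}. optimal_quantities counterexample 1 x = {41})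
    \<and> \<not> continuous_order_property counterexample 1
    \<and> \<not> (\<forall>I. capacitated_inventory_problem I \<longrightarrow>
            (\<forall>t \<in> {1..periods I}. continuous_order_property I t))"
proof -
  have zero: "optimal_quantities counterexample 1 x = {0}" if "x \<in> {602..615}" for x
  proof (rule optimal_quantities_unique)
    fix Q :: nat
    assume "Q \<le> capacity counterexample" "Q \<noteq> 0"
    then show "order_cost counterexample 1 (min_cost counterexample (Suc 1)) x 0
        < order_cost counterexample 1 (min_cost counterexample (Suc 1)) x Q"
      unfolding order_cost_period1_less_iff using period1_level_bounds(1)[OF that, of Q] by simp
  qed simp
  have full: "optimal_quantities counterexample 1 x = {41}" if "x \<in> {616..618}" for x
  proof (rule optimal_quantities_unique)
    fix Q :: nat
    assume "Q \<le> capacity counterexample" "Q \<noteq> 41"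
    then show "order_cost counterexample 1 (min_cost counterexample (Suc 1)) x 41
        < order_cost counterexample 1 (min_cost counterexample (Suc 1)) x Q"
      unfolding order_cost_period1_less_iff
      using period1_level_bounds(2)[OF that] period1_level_bounds(3)[OF that, of Q]
      \<comment> \<open>Against \<open>Q = 0\<close> the saving must exceed the fixed cost; against
        \<open>1, ..., 40\<close> both sides pay it.\<close>
      by (cases "Q = 0") simp_all
  qed simp
  \<comment> \<open>Adjacent levels witness the violation: ordering is optimal at 616 but not just
    below, at 615.\<close>
  have "optimal_to_order counterexample 1 616" "\<not> optimal_to_order counterexample 1 615"
    unfolding optimal_to_order_def using full[of 616] zero[of 615] by auto
  then have not_continuous: "\<not> continuous_order_property counterexample 1"
    unfolding continuous_order_property_def by (intro notI) (auto dest!: spec[of _ 616] spec[of _ 615])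
  moreover have "1 \<in> {1..periods counterexample}" by simp
  ultimately have "\<not> (\<forall>I. capacitated_inventory_problem I \<longrightarrow>
      (\<forall>t \<in> {1..periods I}. continuous_order_property I t))"
    using capacitated_inventory_problem_counterexample by blast
  with not_continuous show ?thesis
    by (intro conjI ballI zero full)
qed

end
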